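(* Let $L_0$ be the space of (classes of) Lebesgue measurable functions $[0,1]\to\mathbb{R}$, where functions equal a.e. are identified, and let $NUP([0,1])\subset L_0^{\mathbb{N}}$ be the family of sequences $(f_n)_n$ such that (A) $f_n\to 0$ pointwise a.e. in $[0,1]$; (B) for every $\varepsilon>0$ there is a measurable set $E\subset[0,1]$ such that $m(E)<\varepsilon$ and $\operatorname{ess\,sup}_{[0,1]\setminus E}|f_n|\to 0$ as $n\to\infty$; (C) $(f_n)_n$ does not converge uniformly a.e. in $[0,1]$. Then $NUP([0,1])$ is strongly $\mathfrak{c}$-algebrable.
   Context: $m$ is Lebesgue measure on $[0,1]$ and $\mathfrak{c}$ is the cardinality of the continuum. $L_0^{\mathbb{N}}$ is the commutative real algebra of all sequences of elements of $L_0$ with coordinatewise operations, elements of $L_0$ being added, multiplied and scaled pointwise a.e. For $A\subset[0,1]$ measurable, $\operatorname{ess\,sup}_{A} f:=\inf\{\alpha\in\mathbb{R}: m(\{x\in A: f(x)>\alpha\})=0\}$. A sequence $(f_n)_n$ converges to $f$ uniformly a.e. in $[0,1]$ if there is $E\subset[0,1]$ with $m(E)=0$ such that $f_n\to f$ uniformly on $[0,1]\setminus E$. A subset $A$ of a commutative real algebra is strongly $\alpha$-algebrable ($\alpha$ a cardinal) if there is a free subalgebra $M$ (not required to be unital) generated by $\alpha$ free generators with $M\setminus\{0\}\subset A$. Equivalently, there is a set $B$ of cardinality $\alpha$, generating a subalgebra $M$ with $M\setminus\{0\}\subset A$, such that for every $s\in\mathbb{N}$, every nonzero real polynomial $P$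 in $s$ variables without constant term, and every choice of distinct $f_1,\dots,f_s\in B$, one has $P(f_1,\dots,f_s)\ne 0$ (so that $P(f_1,\dots,f_s)\in M\setminus\{0\}\subset A$). *)

theory Defs
  imports
    "HOL-Probability.Essential_Supremum"
    "HOL-Library.Function_Algebras"
    "HOL-Library.Poly_Mapping"
begin

unbundle cardinal_syntax

section \<open>The algebra of classes of measurable functions on the unit interval\<close>

abbreviation unit_leb :: "real measure" where
  "unit_leb \<equiv> lebesgue_on {0..1}"

text \<open>
  A function on \<open>[0,1]\<close> is represented by a total function on the reals; its values outside
  \<open>[0,1]\<close> are irrelevant, since all conditions refer to the measure space \<open>unit_leb\<close>, whose
  space is \<open>[0,1]\<close>. The relation is a partial equivalence with domain the measurable functions.
\<close>

definition L0_rel :: "(real \<Rightarrow> real) \<Rightarrow> (real \<Rightarrow> real) \<Rightarrow> bool" where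
  "L0_rel f g \<longleftrightarrow> f \<in> borel_measurable unit_leb \<and> g \<in> borel_measurable unit_leb \<and>
     (AE x in unit_leb. f x = g x)"

quotient_type L0 = "real \<Rightarrow> real" / partial: L0_rel
proof (rule part_equivpI)
  show "\<exists>f. L0_rel f f"
    by (rule exI[of _ "\<lambda>_. 0"]) (simp add: L0_rel_def)
  show "symp L0_rel"
    by (rule sympI) (auto simp: L0_rel_def elim: eventually_mono)
  show "transp L0_rel"
  proof (rule transpI)
    fix f g h assume "L0_rel f g" "L0_rel g h"
    then show "L0_rel f h"
      unfolding L0_rel_def by (auto elim: eventually_elim2)
  qed
qed

instantiation L0 :: "{comm_ring_1, real_algebra_1}"
begin

lift_definition zero_L0 :: L0 is "\<lambda>x. 0"
  by (simp add: L0_rel_def)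

lift_definition one_L0 :: L0 is "\<lambda>x. 1"
  by (simp add: L0_rel_def)

lift_definition plus_L0 :: "L0 \<Rightarrow> L0 \<Rightarrow> L0" is "\<lambda>f g x. f x + g x"
  unfolding L0_rel_def by (auto elim: eventually_elim2)

lift_definition minus_L0 :: "L0 \<Rightarrow> L0 \<Rightarrow> L0" is "\<lambda>f g x. f x - g x"
  unfolding L0_rel_def by (auto elim: eventually_elim2)

lift_definition uminus_L0 :: "L0 \<Rightarrow> L0" is "\<lambda>f x. - f x"
  unfolding L0_rel_def by auto

lift_definition times_L0 :: "L0 \<Rightarrow> L0 \<Rightarrow> L0" is "\<lambda>f g x. f x * g x"
  unfolding L0_rel_def by (auto elim: eventually_elim2)

lift_definition scaleR_L0 :: "real \<Rightarrow> L0 \<Rightarrow> L0" is "\<lambda>c f x. c * f x"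
  unfolding L0_rel_def by (auto elim: eventually_mono)

instance
proof
  show "(0::L0) \<noteq> 1"
  proof (transfer, rule notI)
    assume "L0_rel (\<lambda>x. 0) (\<lambda>x. 1)"
    then have "AE x in unit_leb. False"
      by (simp add: L0_rel_def)
    then have "emeasure unit_leb (space unit_leb) = 0"
      unfolding ae_filter_eq_bot_iff[symmetric] trivial_limit_def .
    then show False
      by (simp add: emeasure_restrict_space)
  qed
qed (transfer; auto simp: L0_rel_def algebra_simps)+

end


section \<open>Function spaces as real algebras\<close>

instantiation "fun" :: (type, scaleR) scaleR
begin

definition scaleR_fun :: "real \<Rightarrow> ('a \<Rightarrow> 'b) \<Rightarrow> 'a \<Rightarrow> 'b" where
  "scaleR_fun c f = (\<lambda>x. c *\<^sub>R f x)"

instance ..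

end

instance "fun" :: (type, real_vector) real_vector
  by standard (simp_all add: scaleR_fun_def fun_eq_iff scaleR_add_right scaleR_add_left)

instance "fun" :: (type, real_algebra) real_algebra
  by standard (simp_all add: scaleR_fun_def fun_eq_iff)

instance "fun" :: (type, real_algebra_1) real_algebra_1 ..


section \<open>Strong algebrability\<close>

text \<open>Subalgebras are not required to contain \<open>1\<close>.\<close>

definition is_subalgebra :: "'a::{comm_ring_1, real_algebra_1} set \<Rightarrow> bool" where
  "is_subalgebra M \<longleftrightarrow> 0 \<in> M \<and> (\<forall>x\<in>M. \<forall>y\<in>M. x + y \<in> M) \<and> (\<forall>x\<in>M. \<forall>y\<in>M. x * y \<in> M) \<and>
     (\<forall>c. \<forall>x\<in>M. c *\<^sub>R x \<in> M)"

definition generated_subalgebra :: "'a::{comm_ring_1, real_algebra_1} set \<Rightarrow> 'a set" where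
  "generated_subalgebra B = is_subalgebra hull B"

text \<open>
  A polynomial maps monomials to coefficients, a monomial maps (indices of) variables to
  exponents; both maps have finite support. So \<open>lookup P 0\<close> is the constant term of \<open>P\<close>.
\<close>

type_synonym real_mpoly = "(nat \<Rightarrow>\<^sub>0 nat) \<Rightarrow>\<^sub>0 real"

definition poly_in_vars :: "nat \<Rightarrow> real_mpoly \<Rightarrow> bool" where
  "poly_in_vars s P \<longleftrightarrow> (\<forall>\<mu>\<in>Poly_Mapping.keys P. Poly_Mapping.keys \<mu> \<subseteq> {..<s})"

definition eval_mpoly :: "real_mpoly \<Rightarrow> (nat \<Rightarrow> 'a) \<Rightarrow> 'a::{comm_ring_1, real_algebra_1}" where
  "eval_mpoly P f = (\<Sum>\<mu>\<in>Poly_Mapping.keys P. Poly_Mapping.lookup P \<mu> *\<^sub>R (\<Prod>i\<in>Poly_Mapping.keys \<mu>. f i ^ Poly_Mapping.lookup \<mu> i))"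

definition free_generators :: "'a::{comm_ring_1, real_algebra_1} set \<Rightarrow> bool" where
  "free_generators B \<longleftrightarrow>
     (\<forall>s P f. P \<noteq> 0 \<and> poly_in_vars s P \<and> Poly_Mapping.lookup P 0 = 0 \<and>
        inj_on f {..<s} \<and> f ` {..<s} \<subseteq> B \<longrightarrow> eval_mpoly P f \<noteq> 0)"

definition strongly_algebrable :: "'k rel \<Rightarrow> 'a::{comm_ring_1, real_algebra_1} set \<Rightarrow> bool" where
  "strongly_algebrable \<kappa> A \<longleftrightarrow>
     (\<exists>B. |B| =o \<kappa> \<and> free_generators B \<and> generated_subalgebra B - {0} \<subseteq> A)"

abbreviation continuum :: "real rel" where
  "continuum \<equiv> |UNIV :: real set|"


section \<open>Modes of convergence in \<open>L0\<close>\<close>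

text \<open>
  The respectfulness proofs show that these notions do not depend on the representatives.
\<close>

lemma L0_rel_seqD:
  fixes f g :: "nat \<Rightarrow> real \<Rightarrow> real"
  assumes r: "\<And>n. L0_rel (f n) (g n)"
  shows "\<And>n. f n \<in> borel_measurable unit_leb" "\<And>n. g n \<in> borel_measurable unit_leb"
    and "AE x in unit_leb. \<forall>n. f n x = g n x"
proof -
  show "\<And>n. f n \<in> borel_measurable unit_leb" "\<And>n. g n \<in> borel_measurable unit_leb"
    using r by (simp_all add: L0_rel_def)
  show "AE x in unit_leb. \<forall>n. f n x = g n x"
    using r by (subst AE_all_countable) (simp add: L0_rel_def)
qed

lift_definition tendsto_ae :: "(nat \<Rightarrow> L0) \<Rightarrow> L0 \<Rightarrow> bool" is
  "\<lambda>f g. AE x in unit_leb. (\<lambda>n. f n x) \<longlonglongrightarrow> g x"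
proof -
  have imp: "AE x in unit_leb. (\<lambda>n. f' n x) \<longlonglongrightarrow> g' x"
    if "AE x in unit_leb. \<forall>n. f n x = f' n x" "AE x in unit_leb. g x = g' x"
      "AE x in unit_leb. (\<lambda>n. f n x) \<longlonglongrightarrow> g x"
    for f f' :: "nat \<Rightarrow> real \<Rightarrow> real" and g g' :: "real \<Rightarrow> real"
    using that by eventually_elim simp
  fix f f' :: "nat \<Rightarrow> real \<Rightarrow> real" and g g' assume "\<And>n. L0_rel (f n) (f' n)" "L0_rel g g'"
  then have "AE x in unit_leb. \<forall>n. f n x = f' n x" "AE x in unit_leb. g x = g' x"
    by (blast intro: L0_rel_seqD(3), simp add: L0_rel_def)
  moreover from this
  have "AE x in unit_leb. \<forall>n. f' n x = f n x" "AE x in unit_leb. g' x = g x"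
    by (auto elim: eventually_mono)
  ultimately show "(AE x in unit_leb. (\<lambda>n. f n x) \<longlonglongrightarrow> g x) \<longleftrightarrow>
      (AE x in unit_leb. (\<lambda>n. f' n x) \<longlonglongrightarrow> g' x)"
    using imp by blast
qed

lift_definition uniform_limit_ae :: "(nat \<Rightarrow> L0) \<Rightarrow> L0 \<Rightarrow> bool" is
  "\<lambda>f g. \<exists>E\<in>null_sets unit_leb. uniform_limit ({0..1} - E) f g sequentially"
proof -
  have imp: "\<exists>E\<in>null_sets unit_leb. uniform_limit ({0..1} - E) f' g' sequentially"
    if ae: "AE x in unit_leb. (\<forall>n. f n x = f' n x) \<and> g x = g' x"
      and ex: "\<exists>E\<in>null_sets unit_leb. uniform_limit ({0..1} - E) f g sequentially"
    for f f' :: "nat \<Rightarrow> real \<Rightarrow> real" and g g' :: "real \<Rightarrow> real"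
  proof -
    from ae obtain N where N: "N \<in> null_sets unit_leb"
        "{x \<in> space unit_leb. \<not> ((\<forall>n. f n x = f' n x) \<and> g x = g' x)} \<subseteq> N"
      unfolding eventually_ae_filter by blast
    have eq: "(\<forall>n. f n x = f' n x) \<and> g x = g' x" if "x \<in> {0..1} - N" for x
      using that N(2) by auto
    from ex obtain E where E: "E \<in> null_sets unit_leb"
        "uniform_limit ({0..1} - E) f g sequentially"
      by blast
    have "uniform_limit ({0..1} - (E \<union> N)) f g sequentially"
      using E(2) by (rule uniform_limit_on_subset) auto
    then have "uniform_limit ({0..1} - (E \<union> N)) f' g' sequentially"
      using eq by (subst (asm) uniform_limit_cong'[where g = f' and i = g']) auto
    then show ?thesis
      using E(1) N(1) by blast
  qed
  fix f f' :: "nat \<Rightarrow> real \<Rightarrow> real" and g g' assume "\<And>n. L0_rel (f n) (f' n)" "L0_rel g g'"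
  then have "AE x in unit_leb. \<forall>n. f n x = f' n x" "AE x in unit_leb. g x = g' x"
    by (blast intro: L0_rel_seqD(3), simp add: L0_rel_def)
  then have ae: "AE x in unit_leb. (\<forall>n. f n x = f' n x) \<and> g x = g' x"
    by eventually_elim auto
  then have ae': "AE x in unit_leb. (\<forall>n. f' n x = f n x) \<and> g' x = g x"
    by eventually_elim auto
  show "(\<exists>E\<in>null_sets unit_leb. uniform_limit ({0..1} - E) f g sequentially) \<longleftrightarrow>
      (\<exists>E\<in>null_sets unit_leb. uniform_limit ({0..1} - E) f' g' sequentially)"
    using imp[OF ae] imp[OF ae'] by blast
qed

text \<open>
  The essential supremum takes values in \<^typ>\<open>ereal\<close>, being infinite if \<open>f n\<close> is
  essentially unbounded or the domain is a null set. By \<open>esssup_eq\<close> it is the infimum of all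
  \<open>z\<close> such that \<open>{x \<in> [0,1] - E. \<bar>f n x\<bar> > z}\<close> is a null set.
\<close>

lift_definition almost_uniformly_null :: "(nat \<Rightarrow> L0) \<Rightarrow> bool" is
  "\<lambda>f. \<forall>\<epsilon>>0. \<exists>E\<in>sets unit_leb. measure unit_leb E < \<epsilon> \<and>
     (\<lambda>n. esssup (lebesgue_on ({0..1} - E)) (\<lambda>x. ereal \<bar>f n x\<bar>)) \<longlonglongrightarrow> 0"
proof -
  fix f f' :: "nat \<Rightarrow> real \<Rightarrow> real" assume r: "\<And>n. L0_rel (f n) (f' n)"
  have "esssup (lebesgue_on ({0..1} - E)) (\<lambda>x. ereal \<bar>f n x\<bar>) =
      esssup (lebesgue_on ({0..1} - E)) (\<lambda>x. ereal \<bar>f' n x\<bar>)" if E: "E \<in> sets unit_leb" for E n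
  proof (rule esssup_AE_cong)
    have D: "{0..1} - E \<in> sets lebesgue"
      using E by (auto simp: sets_restrict_space intro!: sets.Diff)
    have m: "g \<in> borel_measurable (lebesgue_on ({0..1} - E))"
      if "g \<in> borel_measurable unit_leb" for g :: "real \<Rightarrow> real"
      using that by (rule measurable_restrict_mono) auto
    have [measurable]: "f n \<in> borel_measurable (lebesgue_on ({0..1} - E))"
      "f' n \<in> borel_measurable (lebesgue_on ({0..1} - E))"
      using L0_rel_seqD(1,2)[OF r] by (auto intro: m)
    show "(\<lambda>x. ereal \<bar>f n x\<bar>) \<in> borel_measurable (lebesgue_on ({0..1} - E))"
      "(\<lambda>x. ereal \<bar>f' n x\<bar>) \<in> borel_measurable (lebesgue_on ({0..1} - E))"
      by measurable
    have "AE x in lebesgue. x \<in> {0..1} \<longrightarrow> (\<forall>n. f n x = f' n x)"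
      using L0_rel_seqD(3)[OF r] by (subst (asm) AE_restrict_space_iff) auto
    then show "AE x in lebesgue_on ({0..1} - E). ereal \<bar>f n x\<bar> = ereal \<bar>f' n x\<bar>"
      using D by (subst AE_restrict_space_iff) (auto elim: eventually_mono)
  qed
  then show "(\<forall>\<epsilon>>0. \<exists>E\<in>sets unit_leb. measure unit_leb E < \<epsilon> \<and>
        (\<lambda>n. esssup (lebesgue_on ({0..1} - E)) (\<lambda>x. ereal \<bar>f n x\<bar>)) \<longlonglongrightarrow> 0) \<longleftrightarrow>
      (\<forall>\<epsilon>>0. \<exists>E\<in>sets unit_leb. measure unit_leb E < \<epsilon> \<and>
        (\<lambda>n. esssup (lebesgue_on ({0..1} - E)) (\<lambda>x. ereal \<bar>f' n x\<bar>)) \<longlonglongrightarrow> 0)"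
    by (simp cong: bex_cong)
qed

definition NUP :: "(nat \<Rightarrow> L0) set" where
  "NUP = {f. tendsto_ae f 0 \<and> almost_uniformly_null f \<and> \<not> (\<exists>g. uniform_limit_ae f g)}"

end

theory Submission
  imports Defs "HOL-Real_Asymp.Real_Asymp"
begin

text \<open>
  The generators are the sequences obtained from the functions \<open>exp (x powr - exp r)\<close>, for real
  \<open>r\<close>, by restricting them to the shrinking intervals \<open>(0, 1/(n+1))\<close>. Restriction is compatible with
  the algebra operations, so a polynomial without constant term in the generators is the restriction
  of the same polynomial in the functions.

  A monomial in these functions is \<open>exp (phase k x)\<close>, where \<open>phase k\<close> is a combination of distinct
  negative powers of \<open>x\<close> with the exponents of the monomial as coefficients. As \<open>x\<close> decreases to \<open>0\<close>,
  distinct negative powers are of different orders of growth; hence the difference of the phases of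
  two distinct monomials tends to \<open>\<plusminus>\<infinity>\<close>, and so the monomials themselves are of different orders of
  growth. Both here and one level higher the same fact is used: a linear combination with nonzero
  coefficients of functions that tend to infinity with pairwise different orders behaves like its
  largest term (\<open>sum_of_comparable_unbounded_terms\<close>). Applied to monomials, it shows that every
  nontrivial combination of nonconstant monomials tends to \<open>\<plusminus>\<infinity>\<close> at \<open>0\<close>.

  If \<open>g\<close> is unbounded in this way, then its sequence of restrictions lies in \<open>NUP\<close>: the sequence
  vanishes eventually at each point, and it vanishes eventually on all of \<open>(d, 1]\<close> for each \<open>d > 0\<close>;
  but each member is essentially unbounded near \<open>0\<close>, while a uniform limit would be zero almost
  everywhere (\<open>trunc_seq_in_NUP\<close>). As \<open>0\<close> is not in \<open>NUP\<close>, membership in \<open>NUP\<close> yields freeness, and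
  even that distinct indices \<open>r\<close> give distinct generators, so there are continuum many.
\<close>

section \<open>Sums of terms of different orders of growth\<close>

text \<open>
  The order of growth is transitive, so a finite family has a term \<open>h m\<close> of largest order. Dividing
  the sum by \<open>h m\<close> leaves a quotient that tends to \<open>c m\<close>, whose sign decides between the two cases.
\<close>

lemma sum_of_comparable_unbounded_terms:
  fixes h :: "'i \<Rightarrow> 'a \<Rightarrow> real"
  assumes "finite I" "I \<noteq> {}"
    and top: "\<And>i. i \<in> I \<Longrightarrow> filterlim (h i) at_top F"
    and comparable: "\<And>i j. i \<in> I \<Longrightarrow> j \<in> I \<Longrightarrow> i \<noteq> j \<Longrightarrow> h i \<in> o[F](h j) \<or> h j \<in> o[F](h i)"
    and c: "\<And>i. i \<in> I \<Longrightarrow> c i \<noteq> 0"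
  shows "filterlim (\<lambda>x. \<Sum>i\<in>I. c i * h i x) at_top F \<or> filterlim (\<lambda>x. \<Sum>i\<in>I. c i * h i x) at_bot F"
proof -
  have "\<exists>m\<in>I. \<forall>i\<in>I - {m}. h i \<in> o[F](h m)"
    using assms(1,2) comparable
  proof (induction I rule: finite_ne_induct)
    case (insert k J)
    then obtain m where m: "m \<in> J" "\<forall>i\<in>J - {m}. h i \<in> o[F](h m)"
      by (metis insert_iff)
    have "m \<noteq> k"
      using m(1) insert.hyps by blast
    then consider "h k \<in> o[F](h m)" | "h m \<in> o[F](h k)"
      using insert.prems m(1) by blast
    then show ?case
    proof cases
      case 1
      then show ?thesis
        using m by blast
    next
      case 2
      have "h i \<in> o[F](h k)" if "i \<in> J" for i
        using that m(2) 2 landau_o.small_trans[of "h i" F "h m" "h k"] by (cases "i = m") auto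
      then show ?thesis
        by blast
    qed
  qed simp
  then obtain m where m: "m \<in> I" and dom: "\<And>i. i \<in> I - {m} \<Longrightarrow> h i \<in> o[F](h m)"
    by blast
  have "((\<lambda>x. c m + (\<Sum>i\<in>I - {m}. c i * (h i x / h m x))) \<longlongrightarrow> c m + (\<Sum>i\<in>I - {m}. c i * 0)) F"
    by (intro tendsto_intros smalloD_tendsto dom)
  then have q: "((\<lambda>x. c m + (\<Sum>i\<in>I - {m}. c i * (h i x / h m x))) \<longlongrightarrow> c m) F"
    by simp
  have eq: "\<forall>\<^sub>F x in F. (c m + (\<Sum>i\<in>I - {m}. c i * (h i x / h m x))) * h m x = (\<Sum>i\<in>I. c i * h i x)"
    using filterlim_at_top_dense[THEN iffD1, OF top[OF m], rule_format, of 0]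
  proof eventually_elim
    case (elim x)
    then show ?case
      using assms(1) m by (simp add: sum.remove distrib_right sum_distrib_right)
  qed
  show ?thesis
  proof (cases "c m > 0")
    case True
    then show ?thesis
      using filterlim_tendsto_pos_mult_at_top[OF q _ top[OF m]] filterlim_cong[OF refl refl eq] by blast
  next
    case False
    then have "c m < 0"
      using c[OF m] by simp
    then show ?thesis
      using filterlim_tendsto_neg_mult_at_bot[OF q _ top[OF m]] filterlim_cong[OF refl refl eq] by blast
  qed
qed

section \<open>Monomials in exponentials of negative powers\<close>

text \<open>
  A monomial \<open>k\<close> maps the index of a variable to its exponent. The powers are indexed by \<open>exp r\<close>
  instead of \<open>r\<close> so that every real \<open>r\<close> gives a power that is unbounded at \<open>0\<close>.
\<close>

definition phase :: "(real \<Rightarrow>\<^sub>0 nat) \<Rightarrow> real \<Rightarrow> real" where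
  "phase k x = (\<Sum>r\<in>Poly_Mapping.keys k. real (Poly_Mapping.lookup k r) * x powr - exp r)"

definition exp_phase :: "(real \<Rightarrow>\<^sub>0 nat) \<Rightarrow> real \<Rightarrow> real" where
  "exp_phase k x = exp (phase k x)"

lemma exp_phase_borel [measurable]: "exp_phase k \<in> borel_measurable borel"
proof -
  have "(\<lambda>x. exp (\<Sum>r\<in>Poly_Mapping.keys k. real (Poly_Mapping.lookup k r) * x powr - exp r))
      \<in> borel_measurable (borel :: real measure)"
    by measurable
  then show ?thesis
    unfolding exp_phase_def[abs_def] phase_def .
qed

lemma exp_phase_add: "exp_phase (k + l) x = exp_phase k x * exp_phase l x"
proof -
  have "phase (k + l) x = phase k x + phase l x"
    unfolding phase_def by (rule setsum_keys_plus_distrib) (simp_all add: distrib_right)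
  then show ?thesis
    by (simp add: exp_phase_def exp_add)
qed

lemma neg_powr_at_right_0:
  fixes a b :: real
  shows "a > 0 \<Longrightarrow> filterlim (\<lambda>x. x powr - a) at_top (at_right 0)"
    and "a < b \<Longrightarrow> (\<lambda>x. x powr - a) \<in> o[at_right 0](\<lambda>x. x powr - b)"
  by real_asymp+

text \<open>
  In the difference, only those powers remain whose exponents in \<open>k\<close> and \<open>l\<close> differ. There is
  at least one, and the powers that remain are of pairwise different orders of growth.
\<close>

lemma phase_diff_unbounded:
  assumes "k \<noteq> l"
  shows "filterlim (\<lambda>x. phase k x - phase l x) at_top (at_right 0) \<or>
    filterlim (\<lambda>x. phase k x - phase l x) at_bot (at_right 0)"
proof -
  define D where "D = {r. Poly_Mapping.lookup k r \<noteq> Poly_Mapping.lookup l r}"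
  define c where "c r = real (Poly_Mapping.lookup k r) - real (Poly_Mapping.lookup l r)" for r
  have D: "D \<subseteq> Poly_Mapping.keys k \<union> Poly_Mapping.keys l"
    by (auto simp: D_def in_keys_iff)
  have "D \<noteq> {}"
    using assms by (auto simp: D_def poly_mapping_eq_iff fun_eq_iff)
  have phase_eq: "phase j x = (\<Sum>r\<in>Poly_Mapping.keys k \<union> Poly_Mapping.keys l.
      real (Poly_Mapping.lookup j r) * x powr - exp r)" if "j \<in> {k, l}" for j x
    unfolding phase_def using that by (intro sum.mono_neutral_left) (auto simp: in_keys_iff)
  have eq: "(\<lambda>x. phase k x - phase l x) = (\<lambda>x. \<Sum>r\<in>D. c r * x powr - exp r)"
  proof
    fix x
    have "phase k x - phase l x = (\<Sum>r\<in>Poly_Mapping.keys k \<union> Poly_Mapping.keys l. c r * x powr - exp r)"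
      by (simp add: phase_eq c_def left_diff_distrib sum_subtractf)
    also have "\<dots> = (\<Sum>r\<in>D. c r * x powr - exp r)"
      using D by (intro sum.mono_neutral_right) (auto simp: D_def c_def)
    finally show "phase k x - phase l x = (\<Sum>r\<in>D. c r * x powr - exp r)" .
  qed
  show ?thesis
    unfolding eq
  proof (rule sum_of_comparable_unbounded_terms[where h = "\<lambda>r x. x powr - exp r" and c = c])
    show "finite D"
      using D by (rule finite_subset) simp
    fix r s :: real assume "r \<noteq> s"
    then have "exp r < exp s \<or> exp s < exp r"
      by auto
    then show "(\<lambda>x. x powr - exp r) \<in> o[at_right 0](\<lambda>x. x powr - exp s) \<or>
        (\<lambda>x. x powr - exp s) \<in> o[at_right 0](\<lambda>x. x powr - exp r)"
      using neg_powr_at_right_0(2) by blast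
  next
    show "filterlim (\<lambda>x. x powr - exp r) at_top (at_right 0)" for r :: real
      by (rule neg_powr_at_right_0(1)) simp
  qed (use \<open>D \<noteq> {}\<close> in \<open>auto simp: D_def c_def\<close>)
qed

text \<open>
  The phase is its own difference from the phase of \<open>0\<close>, hence tends to \<open>\<plusminus>\<infinity>\<close>; being nonnegative,
  it tends to \<open>\<infinity>\<close>.
\<close>

lemma exp_phase_at_top:
  assumes "k \<noteq> 0"
  shows "filterlim (exp_phase k) at_top (at_right 0)"
proof -
  have nonneg: "phase k x \<ge> 0" for x
    unfolding phase_def by (intro sum_nonneg) auto
  have "\<not> filterlim (phase k) at_bot (at_right 0)"
  proof
    assume "filterlim (phase k) at_bot (at_right 0)"
    then have "\<forall>\<^sub>F x in at_right 0. phase k x < 0"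
      by (simp add: filterlim_at_bot_dense)
    then have "\<forall>\<^sub>F x :: real in at_right 0. False"
      using nonneg by (auto elim!: eventually_mono simp: not_less[symmetric])
    then show False
      by simp
  qed
  moreover have "phase 0 = (\<lambda>x. 0)"
    by (simp add: phase_def fun_eq_iff)
  ultimately have "filterlim (phase k) at_top (at_right 0)"
    using phase_diff_unbounded[OF assms] by simp
  then show ?thesis
    unfolding exp_phase_def[abs_def] by (rule filterlim_compose[OF exp_at_top])
qed

text \<open>The quotient of two monomials is the exponential of the difference of their phases.\<close>

lemma exp_phase_comparable:
  assumes "k \<noteq> l"
  shows "exp_phase k \<in> o[at_right 0](exp_phase l) \<or> exp_phase l \<in> o[at_right 0](exp_phase k)"
proof -
  have small: "exp_phase i \<in> o[at_right 0](exp_phase j)"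
    if "filterlim (\<lambda>x. phase i x - phase j x) at_bot (at_right 0)" for i j
  proof (rule smalloI_tendsto)
    have "((\<lambda>x. exp (phase i x - phase j x)) \<longlongrightarrow> 0) (at_right 0)"
      using that by (rule filterlim_compose[OF exp_at_bot])
    then show "((\<lambda>x. exp_phase i x / exp_phase j x) \<longlongrightarrow> 0) (at_right 0)"
      by (simp add: exp_phase_def exp_diff)
    show "\<forall>\<^sub>F x in at_right 0. exp_phase j x \<noteq> 0"
      by (simp add: exp_phase_def)
  qed
  show ?thesis
    using phase_diff_unbounded[OF assms]
  proof
    assume "filterlim (\<lambda>x. phase k x - phase l x) at_top (at_right 0)"
    then have "filterlim (\<lambda>x. phase l x - phase k x) at_bot (at_right 0)"
      by (simp add: filterlim_uminus_at_bot)
    then show ?thesis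
      by (intro disjI2 small)
  next
    assume "filterlim (\<lambda>x. phase k x - phase l x) at_bot (at_right 0)"
    then show ?thesis
      by (intro disjI1 small)
  qed
qed

section \<open>Cutting a function off to shrinking intervals\<close>

text \<open>
  Functions that are not Borel measurable are sent to \<open>0\<close>, so that every value of \<open>cutoff\<close>
  represents an element of \<open>L0\<close>.
\<close>

definition cutoff :: "(real \<Rightarrow> real) \<Rightarrow> nat \<Rightarrow> real \<Rightarrow> real" where
  "cutoff g n x = (if g \<in> borel_measurable borel \<and> x \<in> {0<..<1 / Suc n} then g x else 0)"

lemma borel_measurable_cutoff: "cutoff g n \<in> borel_measurable unit_leb"
proof (cases "g \<in> borel_measurable borel")
  case True
  have "(\<lambda>x. if x \<in> {0<..<1 / Suc n} then g x else 0) \<in> borel_measurable unit_leb"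
  proof (rule measurable_restrict_space1, rule measurable_completion)
    show "(\<lambda>x. if x \<in> {0<..<1 / Suc n} then g x else 0) \<in> borel_measurable lborel"
      by (rule measurable_If_set) (use True in auto)
  qed
  then show ?thesis
    using True by (simp add: cutoff_def[abs_def])
qed (simp add: cutoff_def[abs_def])

lift_definition trunc_seq :: "(real \<Rightarrow> real) \<Rightarrow> nat \<Rightarrow> L0" is cutoff
  by (simp add: L0_rel_def borel_measurable_cutoff)

lemma L0_rel_cutoffI:
  assumes "\<And>x. cutoff g n x = f x"
  shows "L0_rel (cutoff g n) f"
proof -
  have "f = cutoff g n"
    using assms by (intro ext) simp
  then show ?thesis
    by (simp add: L0_rel_def borel_measurable_cutoff)
qed

lemma trunc_seq_zero: "trunc_seq (\<lambda>x. 0) = 0"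
  unfolding fun_eq_iff zero_fun_def
  by (rule allI, transfer, rule L0_rel_cutoffI) (simp add: cutoff_def)

lemma trunc_seq_add:
  assumes "f \<in> borel_measurable borel" "g \<in> borel_measurable borel"
  shows "trunc_seq (\<lambda>x. f x + g x) = trunc_seq f + trunc_seq g"
  unfolding fun_eq_iff plus_fun_def using assms
  by - (rule allI, transfer, rule L0_rel_cutoffI, auto simp: cutoff_def)

lemma trunc_seq_mult:
  assumes "f \<in> borel_measurable borel" "g \<in> borel_measurable borel"
  shows "trunc_seq (\<lambda>x. f x * g x) = trunc_seq f * trunc_seq g"
  unfolding fun_eq_iff times_fun_def using assms
  by - (rule allI, transfer, rule L0_rel_cutoffI, auto simp: cutoff_def)

lemma trunc_seq_scaleR:
  assumes "f \<in> borel_measurable borel"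
  shows "trunc_seq (\<lambda>x. c * f x) = c *\<^sub>R trunc_seq f"
  unfolding fun_eq_iff scaleR_fun_def using assms
  by - (rule allI, transfer, rule L0_rel_cutoffI, auto simp: cutoff_def)

lemma trunc_seq_sum:
  assumes "finite I" "\<And>i. i \<in> I \<Longrightarrow> h i \<in> borel_measurable borel"
  shows "trunc_seq (\<lambda>x. \<Sum>i\<in>I. c i * h i x) = (\<Sum>i\<in>I. c i *\<^sub>R trunc_seq (h i))"
  using assms
proof (induction I)
  case empty
  then show ?case
    by (simp add: trunc_seq_zero)
next
  case (insert j J)
  have [measurable]: "h i \<in> borel_measurable borel" if "i \<in> insert j J" for i
    using insert.prems that .
  have "trunc_seq (\<lambda>x. c j * h j x + (\<Sum>i\<in>J. c i * h i x)) =
      trunc_seq (\<lambda>x. c j * h j x) + trunc_seq (\<lambda>x. \<Sum>i\<in>J. c i * h i x)"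
    by (rule trunc_seq_add) measurable
  also have "trunc_seq (\<lambda>x. c j * h j x) = c j *\<^sub>R trunc_seq (h j)"
    by (rule trunc_seq_scaleR) measurable
  finally show ?case
    using insert by simp
qed

lemma trunc_seq_tendsto_ae: "tendsto_ae (trunc_seq g) 0"
proof (transfer, rule AE_I2)
  fix g :: "real \<Rightarrow> real" and x :: real
  have "\<forall>\<^sub>F n in sequentially. x \<notin> {0<..<1 / Suc n}"
  proof (cases "x > 0")
    case True
    have "\<forall>\<^sub>F n in sequentially. 1 / Suc n < x"
      using True by real_asymp
    then show ?thesis
      by eventually_elim auto
  qed auto
  then have "\<forall>\<^sub>F n in sequentially. cutoff g n x = 0"
    by (rule eventually_mono) (simp only: cutoff_def, simp)
  then show "(\<lambda>n. cutoff g n x) \<longlonglongrightarrow> 0"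
    by (rule tendsto_eventually)
qed

lemma trunc_seq_almost_uniformly_null: "almost_uniformly_null (trunc_seq g)"
proof (transfer, intro allI impI)
  fix g :: "real \<Rightarrow> real" and \<epsilon> :: real
  assume "\<epsilon> > 0"
  \<comment> \<open>\<open>d\<close> stays below \<open>1\<close> also for large \<open>\<epsilon>\<close>: on a null set the essential supremum is \<open>- \<infinity>\<close>, not \<open>0\<close>.\<close>
  define d where "d = min \<epsilon> 1 / 2"
  have d: "0 < d" "d < \<epsilon>" "d < 1"
    using \<open>\<epsilon> > 0\<close> by (auto simp: d_def min_def)
  have compl: "{0..1} - {0..d} = {d<..1}"
    using d by auto
  have "\<forall>\<^sub>F n in sequentially. 1 / Suc n < d"
    using d(1) by real_asymp
  then have "\<forall>\<^sub>F n in sequentially. esssup (lebesgue_on ({0..1} - {0..d})) (\<lambda>x. ereal \<bar>cutoff g n x\<bar>) = 0"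
  proof eventually_elim
    case (elim n)
    have "esssup (lebesgue_on {d<..1}) (\<lambda>x. ereal \<bar>cutoff g n x\<bar>) = esssup (lebesgue_on {d<..1}) (\<lambda>x. 0)"
    proof (rule esssup_AE_cong)
      have zero: "ereal \<bar>cutoff g n x\<bar> = 0" if "x \<in> space (lebesgue_on {d<..1})" for x
        using that elim by (auto simp: cutoff_def)
      show "AE x in lebesgue_on {d<..1}. ereal \<bar>cutoff g n x\<bar> = 0"
        using zero by (rule AE_I2)
      show "(\<lambda>x. ereal \<bar>cutoff g n x\<bar>) \<in> borel_measurable (lebesgue_on {d<..1})"
        by (subst measurable_cong[OF zero]) auto
    qed simp
    also have "\<dots> = 0"
      using d by (intro esssup_const) (simp add: emeasure_restrict_space)
    finally show ?case
      by (simp only: compl)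
  qed
  then have "(\<lambda>n. esssup (lebesgue_on ({0..1} - {0..d})) (\<lambda>x. ereal \<bar>cutoff g n x\<bar>)) \<longlonglongrightarrow> 0"
    by (rule tendsto_eventually)
  moreover have "{0..d} \<in> sets unit_leb" "measure unit_leb {0..d} < \<epsilon>"
    using d by (auto simp: sets_restrict_space_iff measure_restrict_space)
  ultimately show "\<exists>E\<in>sets unit_leb. measure unit_leb E < \<epsilon> \<and>
      (\<lambda>n. esssup (lebesgue_on ({0..1} - E)) (\<lambda>x. ereal \<bar>cutoff g n x\<bar>)) \<longlonglongrightarrow> 0"
    by blast
qed

text \<open>
  A uniform limit \<open>h\<close> is bounded by \<open>1\<close> outside a null set, because \<open>h\<close> is within \<open>1\<close> of \<open>0\<close> at every
  point where the cut-off functions have vanished. So some cut-off of \<open>g\<close> is bounded by \<open>2\<close> almost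
  everywhere, which contradicts the growth of \<open>g\<close> on an interval next to \<open>0\<close>.
\<close>

lemma trunc_seq_not_uniform_limit_ae:
  assumes "g \<in> borel_measurable borel" "filterlim g at_infinity (at_right 0)"
  shows "\<not> uniform_limit_ae (trunc_seq g) h"
  using assms
proof (transfer, intro notI)
  fix g h :: "real \<Rightarrow> real"
  assume g: "g \<in> borel_measurable borel" "filterlim g at_infinity (at_right 0)"
    and "\<exists>E\<in>null_sets unit_leb. uniform_limit ({0..1} - E) (cutoff g) h sequentially"
  then obtain N where N: "N \<in> null_sets unit_leb"
    and lim: "uniform_limit ({0..1} - N) (cutoff g) h sequentially"
    by blast
  have "\<forall>\<^sub>F n in sequentially. \<forall>x\<in>{0..1} - N. dist (cutoff g n x) (h x) < 1"
    using uniform_limitD[OF lim, of 1] by simp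
  then obtain n where n: "\<And>m x. m \<ge> n \<Longrightarrow> x \<in> {0..1} - N \<Longrightarrow> dist (cutoff g m x) (h x) < 1"
    unfolding eventually_sequentially by blast
  have "\<forall>\<^sub>F x in at_right 0. norm (g x) \<ge> 2"
    using g(2) by (simp add: filterlim_at_infinity[of 0])
  then obtain b where b: "b > 0" "\<And>x. 0 < x \<Longrightarrow> x < b \<Longrightarrow> norm (g x) \<ge> 2"
    unfolding eventually_at_right_field by blast
  define d where "d = min b (1 / Suc n)"
  have d: "0 < d" "d \<le> b" "d \<le> 1 / Suc n"
    using b(1) by (auto simp: d_def)
  then have "d \<le> 1"
    by (smt (verit) divide_le_eq_1 of_nat_0_le_iff of_nat_Suc)
  have "{0<..<d} \<subseteq> N"
  proof
    fix x assume x: "x \<in> {0<..<d}"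
    show "x \<in> N"
    proof (rule ccontr)
      assume "x \<notin> N"
      then have xN: "x \<in> {0..1} - N"
        using x \<open>d \<le> 1\<close> by auto
      have "\<forall>\<^sub>F m in sequentially. 1 / Suc m < x"
        using x by real_asymp
      then obtain m where m: "m \<ge> n" "1 / Suc m < x"
        using eventually_happens'[OF _ eventually_conj[OF eventually_ge_at_top[of n]]] by force
      have "\<bar>h x\<bar> < 1"
        using n[OF m(1) xN] m(2) by (simp add: dist_real_def cutoff_def)
      moreover have "\<bar>g x - h x\<bar> < 1"
        using n[OF order_refl xN] x d g(1) by (simp add: dist_real_def cutoff_def)
      moreover have "\<bar>g x\<bar> \<ge> 2"
        using b(2)[of x] x d by simp
      ultimately show False
        by linarith
    qed
  qed
  moreover have "N \<in> null_sets lebesgue"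
    using N by (simp add: null_sets_restrict_space)
  ultimately have "emeasure lebesgue {0<..<d} = 0"
    by (metis null_setsD1 null_sets_completion_subset)
  then show False
    using d by simp
qed

lemma trunc_seq_in_NUP:
  assumes "g \<in> borel_measurable borel" "filterlim g at_infinity (at_right 0)"
  shows "trunc_seq g \<in> NUP"
  using assms by (simp add: NUP_def trunc_seq_tendsto_ae trunc_seq_almost_uniformly_null
      trunc_seq_not_uniform_limit_ae)

lemma zero_notin_NUP: "0 \<notin> NUP"
proof -
  have "uniform_limit_ae (\<lambda>n. 0) 0"
    by transfer (auto intro!: bexI[of _ "{}"] uniform_limit_const)
  then show ?thesis
    by (auto simp: NUP_def zero_fun_def)
qed

section \<open>The free algebra\<close>

definition monom_seq :: "(real \<Rightarrow>\<^sub>0 nat) \<Rightarrow> nat \<Rightarrow> L0" where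
  "monom_seq k = trunc_seq (exp_phase k)"

lemma monom_seq_add: "monom_seq (k + l) = monom_seq k * monom_seq l"
  unfolding monom_seq_def
  by (subst trunc_seq_mult[symmetric]) (auto simp: exp_phase_add[symmetric])

text \<open>
  This and the next lemma exclude the empty product: \<open>monom_seq 0\<close> is the sequence of indicators of
  the intervals, not the unit of the algebra.
\<close>

lemma monom_seq_single:
  "n > 0 \<Longrightarrow> monom_seq (Poly_Mapping.single r n) = monom_seq (Poly_Mapping.single r 1) ^ n"
proof (induction n rule: nat_induct_non_zero)
  case (Suc n)
  have "Poly_Mapping.single r (Suc n) = Poly_Mapping.single r 1 + Poly_Mapping.single r n"
    by (simp add: single_add[symmetric])
  then show ?case
    using Suc by (simp add: monom_seq_add)
qed simp

lemma monom_seq_sum: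
  assumes "finite A" "A \<noteq> {}"
  shows "monom_seq (\<Sum>i\<in>A. q i) = (\<Prod>i\<in>A. monom_seq (q i))"
  using assms by (induction rule: finite_ne_induct) (simp_all add: monom_seq_add)

text \<open>
  The index set is kept separate from the monomials so that one statement serves for sets of
  monomials in the variables \<open>r\<close> and for the keys of a polynomial in numbered variables.
\<close>

lemma monom_seq_combination_in_NUP:
  assumes "finite I" "I \<noteq> {}" "inj_on \<kappa> I" "\<And>i. i \<in> I \<Longrightarrow> \<kappa> i \<noteq> 0" "\<And>i. i \<in> I \<Longrightarrow> c i \<noteq> 0"
  shows "(\<Sum>i\<in>I. c i *\<^sub>R monom_seq (\<kappa> i)) \<in> NUP"
proof -
  let ?g = "\<lambda>x. \<Sum>i\<in>I. c i * exp_phase (\<kappa> i) x"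
  have "filterlim ?g at_top (at_right 0) \<or> filterlim ?g at_bot (at_right 0)"
    using assms(1,2)
  proof (rule sum_of_comparable_unbounded_terms)
    fix i j assume "i \<in> I" "j \<in> I" "i \<noteq> j"
    then show "exp_phase (\<kappa> i) \<in> o[at_right 0](exp_phase (\<kappa> j)) \<or>
        exp_phase (\<kappa> j) \<in> o[at_right 0](exp_phase (\<kappa> i))"
      using assms(3) by (intro exp_phase_comparable) (auto dest: inj_onD)
  qed (use assms(4,5) in \<open>auto intro: exp_phase_at_top\<close>)
  then have "filterlim ?g at_infinity (at_right 0)"
    using filterlim_at_top_imp_at_infinity filterlim_at_bot_imp_at_infinity by blast
  then have "trunc_seq ?g \<in> NUP"
    by (intro trunc_seq_in_NUP) auto
  then show ?thesis
    unfolding monom_seq_def using assms(1) by (simp add: trunc_seq_sum)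
qed

lemma is_subalgebra_span:
  assumes mult: "\<And>x y. x \<in> V \<Longrightarrow> y \<in> V \<Longrightarrow> x * y \<in> V"
  shows "is_subalgebra (span V)"
proof -
  have left: "x * y \<in> span V" if "x \<in> V" "y \<in> span V" for x y
    using that(2)
  proof (induction rule: span_induct_alt)
    case (step c v w)
    then show ?case
      using mult[OF that(1), of v] by (simp add: distrib_left span_add span_scale span_base)
  qed (simp add: span_zero)
  have "x * y \<in> span V" if "x \<in> span V" "y \<in> span V" for x y
    using that(1)
  proof (induction rule: span_induct_alt)
    case (step c v w)
    then show ?case
      using left[of v y] that(2) by (simp add: distrib_right span_add span_scale)
  qed (simp add: span_zero)
  then show ?thesis
    by (simp add: is_subalgebra_def span_zero span_add span_scale)
qed

text \<open>
  Dropping the terms with coefficient \<open>0\<close> from a combination of monomials leaves a nontrivial one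
  unless its value is \<open>0\<close>.
\<close>

lemma span_monom_seq_subset_NUP: "span (monom_seq ` (- {0})) - {0} \<subseteq> NUP"
proof
  fix x assume x: "x \<in> span (monom_seq ` (- {0})) - {0}"
  then obtain t u where t: "finite t" "t \<subseteq> monom_seq ` (- {0})" "(\<Sum>a\<in>t. u a *\<^sub>R a) = x"
    unfolding span_explicit by blast
  then obtain K where K: "K \<subseteq> - {0}" "inj_on monom_seq K" "t = monom_seq ` K"
    by (auto simp: subset_image_inj)
  define I where "I = {k\<in>K. u (monom_seq k) \<noteq> 0}"
  have "finite K"
    using K t(1) finite_imageD by blast
  have "x = (\<Sum>k\<in>K. u (monom_seq k) *\<^sub>R monom_seq k)"
    using t(3) K by (simp add: sum.reindex)
  also have "\<dots> = (\<Sum>k\<in>I. u (monom_seq k) *\<^sub>R monom_seq k)"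
    using \<open>finite K\<close> by (intro sum.mono_neutral_right) (auto simp: I_def)
  finally have x_eq: "x = (\<Sum>k\<in>I. u (monom_seq k) *\<^sub>R monom_seq k)" .
  with x have "I \<noteq> {}"
    by auto
  then show "x \<in> NUP"
    unfolding x_eq using \<open>finite K\<close> K(1)
    by (intro monom_seq_combination_in_NUP) (auto simp: I_def)
qed

text \<open>
  If two distinct monomials gave the same sequence, the difference of these sequences would be a
  nontrivial combination of monomials that is \<open>0\<close>, hence not in \<open>NUP\<close>.
\<close>

lemma inj_on_monom_seq: "inj_on monom_seq (- {0})"
proof (rule inj_onI, rule ccontr)
  fix k l assume kl: "k \<in> - {0}" "l \<in> - {0}" "monom_seq k = monom_seq l" "k \<noteq> l"
  define c :: "(real \<Rightarrow>\<^sub>0 nat) \<Rightarrow> real" where "c i = (if i = k then 1 else - 1)" for i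
  have "(\<Sum>i\<in>{k, l}. c i *\<^sub>R monom_seq i) \<in> NUP"
    using kl(1,2) by (intro monom_seq_combination_in_NUP[where \<kappa> = "\<lambda>i. i"]) (auto simp: c_def)
  moreover have "(\<Sum>i\<in>{k, l}. c i *\<^sub>R monom_seq i) = 0"
    using kl(3,4) by (simp add: c_def)
  ultimately show False
    using zero_notin_NUP by simp
qed

lemma single_one_nonzero: "Poly_Mapping.single r (1 :: nat) \<noteq> 0"
proof
  assume "Poly_Mapping.single r (1 :: nat) = 0"
  then have "Poly_Mapping.lookup (Poly_Mapping.single r (1 :: nat)) r = 0"
    by (simp only: lookup_zero)
  then show False
    by simp
qed

definition generator :: "real \<Rightarrow> nat \<Rightarrow> L0" where
  "generator r = monom_seq (Poly_Mapping.single r 1)"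

lemma inj_generator: "inj generator"
proof (rule injI)
  fix r s :: real assume "generator r = generator s"
  then have "monom_seq (Poly_Mapping.single r 1) = monom_seq (Poly_Mapping.single s 1)"
    by (simp only: generator_def)
  then have eq: "Poly_Mapping.single r (1 :: nat) = Poly_Mapping.single s 1"
    by (rule inj_onD[OF inj_on_monom_seq])
      (simp_all only: Compl_iff singleton_iff single_one_nonzero simp_thms)
  have "Poly_Mapping.lookup (Poly_Mapping.single s (1 :: nat)) r = 1"
    by (simp only: eq[symmetric] lookup_single_eq)
  then show "r = s"
    by (simp add: lookup_single when_def split: if_splits)
qed

text \<open>
  Substituting the generators with indices \<open>r i\<close> turns a monomial \<open>\<mu>\<close> in numbered variables into the
  monomial \<open>\<kappa> \<mu>\<close> that carries the exponent of \<open>i\<close> to \<open>r i\<close>. Since \<open>r\<close> is injective on the variables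
  in use, \<open>\<kappa>\<close> is injective on the monomials in \<open>P\<close>, so no terms of \<open>P\<close> merge or cancel.
\<close>

lemma free_generators_generator: "free_generators (range generator)"
  unfolding free_generators_def
proof (intro allI impI, elim conjE)
  fix s P and f :: "nat \<Rightarrow> nat \<Rightarrow> L0"
  assume P: "P \<noteq> 0" "poly_in_vars s P" "Poly_Mapping.lookup P 0 = 0"
    and f: "inj_on f {..<s}" "f ` {..<s} \<subseteq> range generator"
  have "\<forall>i\<in>{..<s}. \<exists>a. f i = generator a"
    using f(2) by blast
  then obtain r where r: "\<And>i. i < s \<Longrightarrow> f i = generator (r i)"
    by (metis lessThan_iff)
  have inj_r: "i = j" if "i < s" "j < s" "r i = r j" for i j
    using that r[of i] r[of j] by (intro inj_onD[OF f(1)]) simp_all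
  define \<kappa> where "\<kappa> \<mu> = (\<Sum>i\<in>Poly_Mapping.keys \<mu>. Poly_Mapping.single (r i) (Poly_Mapping.lookup \<mu> i))"
    for \<mu> :: "nat \<Rightarrow>\<^sub>0 nat"
  have keys: "i < s" if "\<mu> \<in> Poly_Mapping.keys P" "i \<in> Poly_Mapping.keys \<mu>" for \<mu> i
    using P(2) that by (auto simp: poly_in_vars_def)
  have nonzero: "\<mu> \<noteq> 0" if "\<mu> \<in> Poly_Mapping.keys P" for \<mu>
    using P(3) that by (auto simp: in_keys_iff)
  have lookup_\<kappa>: "Poly_Mapping.lookup (\<kappa> \<mu>) (r i) = Poly_Mapping.lookup \<mu> i"
    if "\<mu> \<in> Poly_Mapping.keys P" "i < s" for \<mu> i
  proof -
    have "Poly_Mapping.lookup (\<kappa> \<mu>) (r i) =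
        (\<Sum>j\<in>Poly_Mapping.keys \<mu>. if j = i then Poly_Mapping.lookup \<mu> j else 0)"
      unfolding \<kappa>_def lookup_sum
      by (intro sum.cong refl) (use inj_r keys that in \<open>auto simp: lookup_single when_def\<close>)
    then show ?thesis
      by (simp add: in_keys_iff)
  qed
  have lookup_out: "Poly_Mapping.lookup \<mu> i = 0" if "\<mu> \<in> Poly_Mapping.keys P" "\<not> i < s" for \<mu> i
    using keys that by (auto simp: in_keys_iff)
  have "inj_on \<kappa> (Poly_Mapping.keys P)"
  proof (intro inj_onI poly_mapping_eqI)
    fix \<mu> \<nu> i assume \<mu>\<nu>: "\<mu> \<in> Poly_Mapping.keys P" "\<nu> \<in> Poly_Mapping.keys P" "\<kappa> \<mu> = \<kappa> \<nu>"
    show "Poly_Mapping.lookup \<mu> i = Poly_Mapping.lookup \<nu> i"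
    proof (cases "i < s")
      case True
      then show ?thesis
        using lookup_\<kappa>[OF \<mu>\<nu>(1) True] lookup_\<kappa>[OF \<mu>\<nu>(2) True] \<mu>\<nu>(3) by simp
    qed (use lookup_out \<mu>\<nu> in simp)
  qed
  moreover have "\<kappa> \<mu> \<noteq> 0" if \<mu>: "\<mu> \<in> Poly_Mapping.keys P" for \<mu>
  proof
    assume "\<kappa> \<mu> = 0"
    obtain i where i: "i \<in> Poly_Mapping.keys \<mu>"
      using nonzero[OF \<mu>] by (metis all_not_in_conv keys_eq_empty)
    then show False
      using lookup_\<kappa>[OF \<mu> keys[OF \<mu> i]] \<open>\<kappa> \<mu> = 0\<close> by (simp add: in_keys_iff)
  qed
  ultimately have "(\<Sum>\<mu>\<in>Poly_Mapping.keys P. Poly_Mapping.lookup P \<mu> *\<^sub>R monom_seq (\<kappa> \<mu>)) \<in> NUP"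
    using P(1) by (intro monom_seq_combination_in_NUP) (auto simp: in_keys_iff)
  moreover have "monom_seq (\<kappa> \<mu>) = (\<Prod>i\<in>Poly_Mapping.keys \<mu>. f i ^ Poly_Mapping.lookup \<mu> i)"
    if "\<mu> \<in> Poly_Mapping.keys P" for \<mu>
  proof -
    have "monom_seq (\<kappa> \<mu>) =
        (\<Prod>i\<in>Poly_Mapping.keys \<mu>. monom_seq (Poly_Mapping.single (r i) (Poly_Mapping.lookup \<mu> i)))"
      unfolding \<kappa>_def using nonzero[OF that] by (intro monom_seq_sum) auto
    also have "\<dots> = (\<Prod>i\<in>Poly_Mapping.keys \<mu>. f i ^ Poly_Mapping.lookup \<mu> i)"
    proof (intro prod.cong refl)
      fix i assume i: "i \<in> Poly_Mapping.keys \<mu>"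
      have "f i = monom_seq (Poly_Mapping.single (r i) 1)"
        using r[OF keys[OF that i]] by (simp only: generator_def)
      moreover have "Poly_Mapping.lookup \<mu> i > 0"
        using i by (simp add: in_keys_iff)
      ultimately show "monom_seq (Poly_Mapping.single (r i) (Poly_Mapping.lookup \<mu> i)) =
          f i ^ Poly_Mapping.lookup \<mu> i"
        by (simp only: monom_seq_single[of "Poly_Mapping.lookup \<mu> i"])
    qed
    finally show ?thesis .
  qed
  ultimately have "eval_mpoly P f \<in> NUP"
    unfolding eval_mpoly_def by (simp only: cong: sum.cong)
  then show "eval_mpoly P f \<noteq> 0"
    using zero_notin_NUP by auto
qed

theorem theorem3p3:
  shows "strongly_algebrable continuum NUP"
  unfolding strongly_algebrable_def
proof (intro exI conjI)
  show "|range generator| =o continuum"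
    using inj_generator card_of_ordIso[of "UNIV :: real set" "range generator"] ordIso_symmetric
    by (auto simp: bij_betw_def)
  show "free_generators (range generator)"
    by (rule free_generators_generator)
  have "is_subalgebra (span (monom_seq ` (- {0})))"
  proof (rule is_subalgebra_span)
    fix x y assume "x \<in> monom_seq ` (- {0})" "y \<in> monom_seq ` (- {0})"
    then obtain k l where kl: "k \<noteq> 0" "l \<noteq> 0" "x = monom_seq k" "y = monom_seq l"
      by auto
    \<comment> \<open>Exponents are natural numbers, so they cannot cancel.\<close>
    have "k + l \<noteq> 0"
      using kl(1) by (metis add_eq_0_iff_both_eq_0 lookup_add lookup_zero poly_mapping_eqI)
    then show "x * y \<in> monom_seq ` (- {0})"
      using kl by (auto simp: monom_seq_add[symmetric])
  qed
  moreover have "range generator \<subseteq> span (monom_seq ` (- {0}))"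
    unfolding generator_def
    by (intro image_subsetI span_base imageI)
      (simp only: Compl_iff singleton_iff single_one_nonzero simp_thms)
  ultimately have "generated_subalgebra (range generator) \<subseteq> span (monom_seq ` (- {0}))"
    unfolding generated_subalgebra_def by (intro hull_minimal)
  then show "generated_subalgebra (range generator) - {0} \<subseteq> NUP"
    using span_monom_seq_subset_NUP by blast
qed

end
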